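(* Let $a<b$ be real numbers, $d\ge 1$ an integer, $1<p<\infty$, $0<\alpha<1$ and $u_0\in\mathbb{R}^d$. Let $L:(\mathbb{R}^d)^4\times[a,b]\to\mathbb{R}$ be of class $C^1$, let $W^{1,p}_a=\{u\in W^{1,p}(a,b;\mathbb{R}^d): u(a)=u_0\}$, and consider the functional $$\mathcal{L}:W^{1,p}_a\to\mathbb{R},\qquad \mathcal{L}(u)=\int_a^b L\big(u(t),I^{\alpha}_{-}[u](t),\dot u(t),{}_{c}D^{\alpha}_{-}[u](t),t\big)\,dt .$$ Assume that $$L(x_1,x_2,x_3,x_4,t)\ \ge\ c_0\|x_3\|^p+\sum_{k=1}^{N}c_k\|x_1\|^{d_{1,k}}\|x_2\|^{d_{2,k}}\|x_3\|^{d_{3,k}}\|x_4\|^{d_{4,k}}$$ for all $(x_1,x_2,x_3,x_4,t)\in(\mathbb{R}^d)^4\times[a,b]$, where $c_0>0$, $N\ge1$ is an integer, and for every $k=1,\dots,N$ we have $c_k\in\mathbb{R}$ and real exponents $d_{1,k},d_{2,k},d_{3,k},d_{4,k}\ge0$ with $$0\le d_{1,k}+d_{2,k}+d_{3,k}+d_{4,k}<p .$$ Then $\mathcal{L}$ is coercive on $W^{1,p}_a$.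
   Context: $W^{1,p}=W^{1,p}(a,b;\mathbb{R}^d)$ is the usual Sobolev space with its usual norm; its elements are identified with their continuous representatives, and $\dot u$ denotes the derivative of $u$. $\|\cdot\|$ is the Euclidean norm on $\mathbb{R}^d$, and $s^0=1$ for all $s\ge0$. It is part of the setting that $\mathcal{L}(u)$ is a well-defined real number for each $u\in W^{1,p}_a$. For $\beta>0$ and $f\in L^1(a,b;\mathbb{R}^d)$, the left Riemann--Liouville fractional integral is $I^{\beta}_{-}[f](t)=\frac{1}{\Gamma(\beta)}\int_a^t (t-y)^{\beta-1}f(y)\,dy$ (defined for a.e. $t\in(a,b)$). For $0<\alpha<1$ and $f\in W^{1,1}(a,b;\mathbb{R}^d)$, the left Caputo fractional derivative is ${}_{c}D^{\alpha}_{-}[f]=I^{1-\alpha}_{-}[\dot f]$. $\mathcal{L}$ is called coercive on a set $E\subset W^{1,p}$ if $\mathcal{L}(u)\to+\infty$ as $\|u\|_{W^{1,p}}\to\infty$ with $u\in E$. *)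

theory Defs
  imports "HOL-Analysis.Analysis"
begin

text \<open>Functions on $(a,b)$ are total functions on the reals of which only the values on $[a,b]$
  matter. Elements of $L^p$ are represented by Borel measurable functions; every class of a.e. equal
  Lebesgue measurable functions contains one.\<close>

definition in_Lp :: "real \<Rightarrow> real \<Rightarrow> real \<Rightarrow> (real \<Rightarrow> 'a::euclidean_space) \<Rightarrow> bool" where
  "in_Lp a b p f \<longleftrightarrow>
     set_borel_measurable lborel {a..b} f \<and>
     set_integrable lborel {a..b} (\<lambda>t. norm (f t) powr p)"

definition Lp_norm :: "real \<Rightarrow> real \<Rightarrow> real \<Rightarrow> (real \<Rightarrow> 'a::euclidean_space) \<Rightarrow> real" where
  "Lp_norm a b p f = (LINT t:{a..b}|lborel. norm (f t) powr p) powr (1 / p)"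

definition test_fun :: "real \<Rightarrow> real \<Rightarrow> (real \<Rightarrow> real) \<Rightarrow> bool" where
  "test_fun a b \<phi> \<longleftrightarrow>
     \<phi> C1_differentiable_on UNIV \<and>
     compact (closure {t. \<phi> t \<noteq> 0}) \<and> closure {t. \<phi> t \<noteq> 0} \<subseteq> {a<..<b}"

text \<open>Weak derivatives are tested against $C^1_c(a,b)$, as in Brezis' textbook; by mollification,
  $C^\infty_c(a,b)$ gives the same notion. Integrability of the derivative on the bounded interval is
  built in, which is no restriction for derivatives in $L^p$ with $p \ge 1$.\<close>

definition has_weak_deriv ::
  "real \<Rightarrow> real \<Rightarrow> (real \<Rightarrow> 'a::euclidean_space) \<Rightarrow> (real \<Rightarrow> 'a) \<Rightarrow> bool" where
  "has_weak_deriv a b u v \<longleftrightarrow>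
     set_integrable lborel {a..b} u \<and> set_integrable lborel {a..b} v \<and>
     (\<forall>\<phi>. test_fun a b \<phi> \<longrightarrow>
        (LINT t:{a..b}|lborel. deriv \<phi> t *\<^sub>R u t) = - (LINT t:{a..b}|lborel. \<phi> t *\<^sub>R v t))"

text \<open>The weak derivative is unique up to null sets, and everything below depends only on its
  a.e. class.\<close>

definition weak_deriv ::
  "real \<Rightarrow> real \<Rightarrow> (real \<Rightarrow> 'a::euclidean_space) \<Rightarrow> real \<Rightarrow> 'a" where
  "weak_deriv a b u = (SOME v. has_weak_deriv a b u v)"

text \<open>The condition \<^term>\<open>continuous_on {a..b} u\<close> selects the continuous representative.\<close>

definition W1p :: "real \<Rightarrow> real \<Rightarrow> real \<Rightarrow> (real \<Rightarrow> 'a::euclidean_space) set" where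
  "W1p a b p =
     {u. continuous_on {a..b} u \<and> (\<exists>v. has_weak_deriv a b u v) \<and>
         in_Lp a b p u \<and> in_Lp a b p (weak_deriv a b u)}"

definition W1p_norm :: "real \<Rightarrow> real \<Rightarrow> real \<Rightarrow> (real \<Rightarrow> 'a::euclidean_space) \<Rightarrow> real" where
  "W1p_norm a b p u =
     (Lp_norm a b p u powr p + Lp_norm a b p (weak_deriv a b u) powr p) powr (1 / p)"

definition W1p_init :: "real \<Rightarrow> real \<Rightarrow> real \<Rightarrow> 'a \<Rightarrow> (real \<Rightarrow> 'a::euclidean_space) set" where
  "W1p_init a b p u0 = {u \<in> W1p a b p. u a = u0}"

definition RL_integral :: "real \<Rightarrow> real \<Rightarrow> (real \<Rightarrow> 'a::euclidean_space) \<Rightarrow> real \<Rightarrow> 'a" where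
  "RL_integral a \<beta> f t =
     (1 / Gamma \<beta>) *\<^sub>R (LINT y:{a..t}|lborel. (t - y) powr (\<beta> - 1) *\<^sub>R f y)"

definition caputo_deriv ::
  "real \<Rightarrow> real \<Rightarrow> real \<Rightarrow> (real \<Rightarrow> 'a::euclidean_space) \<Rightarrow> real \<Rightarrow> 'a" where
  "caputo_deriv a b \<alpha> f = RL_integral a (1 - \<alpha>) (weak_deriv a b f)"

text \<open>Class $C^1$ on a set that need not be open; used below for sets on which the derivative relative
  to the set is unique.\<close>

definition C1_on :: "'a::real_normed_vector set \<Rightarrow> ('a \<Rightarrow> 'b::real_normed_vector) \<Rightarrow> bool" where
  "C1_on S f \<longleftrightarrow>
     (\<exists>f' :: 'a \<Rightarrow> 'a \<Rightarrow>\<^sub>L 'b.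
        (\<forall>z\<in>S. (f has_derivative blinfun_apply (f' z)) (at z within S)) \<and> continuous_on S f')"

definition lagrangian_at ::
  "('a \<times> 'a \<times> 'a \<times> 'a \<times> real \<Rightarrow> real) \<Rightarrow> real \<Rightarrow> real \<Rightarrow> real \<Rightarrow>
   (real \<Rightarrow> 'a::euclidean_space) \<Rightarrow> real \<Rightarrow> real" where
  "lagrangian_at L a b \<alpha> u t =
     L (u t, RL_integral a \<alpha> u t, weak_deriv a b u t, caputo_deriv a b \<alpha> u t, t)"

definition frac_functional ::
  "('a \<times> 'a \<times> 'a \<times> 'a \<times> real \<Rightarrow> real) \<Rightarrow> real \<Rightarrow> real \<Rightarrow> real \<Rightarrow>
   (real \<Rightarrow> 'a::euclidean_space) \<Rightarrow> real" where
  "frac_functional L a b \<alpha> u = (LINT t:{a..b}|lborel. lagrangian_at L a b \<alpha> u t)"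

definition coercive_on ::
  "real \<Rightarrow> real \<Rightarrow> real \<Rightarrow> (real \<Rightarrow> 'a::euclidean_space) set \<Rightarrow>
   ((real \<Rightarrow> 'a) \<Rightarrow> real) \<Rightarrow> bool" where
  "coercive_on a b p E F \<longleftrightarrow>
     filterlim F at_top (inf (filtercomap (W1p_norm a b p) at_top) (principal E))"

text \<open>Powers with the convention $s^0 = 1$ also for $s = 0$, whereas \<^term>\<open>(0::real) powr 0 = 0\<close>.\<close>

definition rpow :: "real \<Rightarrow> real \<Rightarrow> real" where
  "rpow s e = (if e = 0 then 1 else s powr e)"

end

theory Submission
  imports Defs
begin

text \<open>Put \<open>A = \<integral> \<parallel>u'\<parallel>\<^sup>p\<close>. Since \<open>u(a)\<close> is prescribed, \<open>u(t) = u(a) + \<integral>\<^sub>a\<^sup>t u'\<close> bounds \<open>\<parallel>u\<parallel>\<^sup>p\<close>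
  and \<open>\<parallel>I\<^sup>\<alpha> u\<parallel>\<^sup>p\<close> uniformly by \<open>C (1 + A)\<close>, and Young's inequality for the convolution with the integrable
  kernel \<open>s powr (-\<alpha>)\<close> bounds the integral of the \<open>p\<close>-th power of the Caputo derivative by \<open>C (1 + A)\<close>.
  The mixed terms have total degree below \<open>p\<close>, hence are at least \<open>-\<epsilon> \<Sum> \<parallel>x\<^sub>i\<parallel>\<^sup>p - C\<^sub>\<epsilon>\<close>; for small \<open>\<epsilon>\<close>
  they cost at most half of \<open>c\<^sub>0 A\<close>. So the functional is at least \<open>(c\<^sub>0/2) A - C\<close>, while the \<open>p\<close>-th power
  of the Sobolev norm is at most \<open>C (1 + A)\<close>.\<close>

section \<open>A C^1 cutoff and the fundamental theorem of calculus for weak derivatives\<close>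

text \<open>The hat function on [0, 2] with peak 1 at 1. Writing it with absolute values makes
  continuity and measurability immediate.\<close>

definition tent :: "real \<Rightarrow> real" where
  "tent x = (\<bar>x\<bar> - 2 * \<bar>x - 1\<bar> + \<bar>x - 2\<bar>) / 2"

text \<open>The antiderivative of \<open>tent\<close>: each absolute value
  \<open>\<bar>y\<bar>\<close> is replaced by \<open>y * \<bar>y\<bar> / 2\<close>, and the constant
  1/2 normalises the value on the negative axis to 0.\<close>

definition smooth_step :: "real \<Rightarrow> real" where
  "smooth_step x = (x * \<bar>x\<bar> - 2 * ((x - 1) * \<bar>x - 1\<bar>) + (x - 2) * \<bar>x - 2\<bar>) / 4 + 1 / 2"

lemma smooth_step_le_0: "x \<le> 0 \<Longrightarrow> smooth_step x = 0"
  by (simp add: smooth_step_def algebra_simps)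

lemma smooth_step_ge_2: "x \<ge> 2 \<Longrightarrow> smooth_step x = 1"
  by (simp add: smooth_step_def algebra_simps)

lemma smooth_step_bounds: "0 \<le> smooth_step x" "smooth_step x \<le> 1"
proof -
  consider "x \<le> 0" | "0 \<le> x" "x \<le> 1" | "1 \<le> x" "x \<le> 2" | "2 \<le> x" by linarith
  then have "0 \<le> smooth_step x \<and> smooth_step x \<le> 1"
  proof cases
    case 2
    then have "smooth_step x = x\<^sup>2 / 2" 
      by (simp add: smooth_step_def field_simps power2_eq_square)
    moreover have "x\<^sup>2 \<le> 1" using 2 by (simp add: power_le_one)
    ultimately show ?thesis using zero_le_power2[of x] by linarith
  next
    case 3
    then have "smooth_step x = 1 - (2 - x)\<^sup>2 / 2" 
      by (simp add: smooth_step_def field_simps power2_eq_square)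
    moreover have "(2 - x)\<^sup>2 \<le> 1" using 3 by (simp add: power_le_one)
    ultimately show ?thesis using zero_le_power2[of "2 - x"] by linarith
  qed (simp_all add: smooth_step_le_0 smooth_step_ge_2)
  then show "0 \<le> smooth_step x" "smooth_step x \<le> 1" by auto
qed

text \<open>Near a nonzero point the function is \<open>x * x\<close> or its negative; at 0 the
  difference quotient is \<open>\<bar>h\<bar>\<close>. This is what makes \<open>smooth_step\<close>
  of class C^1.\<close>

lemma has_real_derivative_mult_abs: "((\<lambda>x::real. x * \<bar>x\<bar>) has_real_derivative 2 * \<bar>x\<bar>) (at x)"
proof (cases "x = 0")
  case True
  have "(\<lambda>h::real. \<bar>h\<bar>) \<midarrow>0\<rightarrow> 0" using tendsto_rabs[OF tendsto_ident_at, of 0 UNIV] by simp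
  then have "(\<lambda>h::real. h * \<bar>h\<bar> / h) \<midarrow>0\<rightarrow> 0"
    by (rule Lim_transform_eventually) (simp add: eventually_at_filter)
  then show ?thesis using True by (simp add: DERIV_def)
next
  case False
  then consider "x < 0" | "0 < x" by linarith
  then show ?thesis
  proof cases
    case 1
    have "((\<lambda>x. - (x * x)) has_real_derivative - (2 * x)) (at x)"
      by (auto intro!: derivative_eq_intros)
    with 1 show ?thesis
      using has_field_derivative_transform_within_open[of "\<lambda>x. - (x * x)" _ x "{..<0}"] by force
  next
    case 2
    have "((\<lambda>x. x * x) has_real_derivative 2 * x) (at x)"
      by (auto intro!: derivative_eq_intros)
    with 2 show ?thesis
      using has_field_derivative_transform_within_open[of "\<lambda>x. x * x" _ x "{0<..}"] by force
  qed
qed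

lemma has_real_derivative_smooth_step: "(smooth_step has_real_derivative tent x) (at x)"
proof -
  have s: "((\<lambda>x. (x - c) * \<bar>x - c\<bar>) has_real_derivative 2 * \<bar>x - c\<bar>) (at x)" for c
    using DERIV_shift[of "\<lambda>x. x * \<bar>x\<bar>" "2 * \<bar>x - c\<bar>" x "-c"]
    by (simp add: has_real_derivative_mult_abs)
  show ?thesis
    unfolding smooth_step_def tent_def
    by (rule derivative_eq_intros s has_real_derivative_mult_abs refl | simp)+
qed

lemma isCont_tent: "isCont tent x"
  unfolding tent_def by (intro continuous_intros) auto

lemma tent_measurable [measurable]: "tent \<in> borel_measurable borel"
  unfolding tent_def by measurable

lemma tent_eq_0: "\<not> (0 < x \<and> x < 2) \<Longrightarrow> tent x = 0"
  by (auto simp: tent_def)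

lemma abs_tent_le: "\<bar>tent x\<bar> \<le> indicator {0..2} x"
  by (auto simp: tent_def indicator_def abs_real_def)

lemma integrable_tent: "integrable lborel tent"
proof (rule Bochner_Integration.integrable_bound)
  show "integrable lborel (indicator {0..2} :: real \<Rightarrow> real)"
    by (auto intro!: integrable_real_indicator)
qed (use abs_tent_le in auto)

lemma integral_tent: "(LINT x|lborel. tent x) = 1"
proof -
  have "has_bochner_integral lborel (\<lambda>x. tent x * indicator {0..2} x) (smooth_step 2 - smooth_step 0)"
    by (rule has_bochner_integral_FTC_Icc_real)
       (auto intro!: has_real_derivative_smooth_step isCont_tent)
  also have "(\<lambda>x. tent x * indicator {0..2} x) = tent"
  proof
    show "tent x * indicator {0..2} x = tent x" for x
      using tent_eq_0[of x] by (cases "0 < x \<and> x < 2") auto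
  qed
  finally show ?thesis
    by (simp add: has_bochner_integral_iff smooth_step_le_0 smooth_step_ge_2)
qed

text \<open>Substituting \<open>x = c + (m + y) / n\<close> turns the scaled tent into a fixed one.\<close>

lemma tent_approximate_identity:
  fixes F :: "real \<Rightarrow> 'a::euclidean_space"
  assumes [measurable]: "F \<in> borel_measurable borel"
    and bounded: "\<And>x. norm (F x) \<le> M"
    and lim: "\<And>y. 0 < y \<Longrightarrow> y < 2 \<Longrightarrow> (\<lambda>n. F (c + (m + y) / real n)) \<longlonglongrightarrow> l"
  shows "(\<lambda>n. LINT x|lborel. (real n * tent (real n * (x - c) - m)) *\<^sub>R F x) \<longlonglongrightarrow> l"
proof -
  have "(\<lambda>n. LINT y|lborel. tent y *\<^sub>R F (c + (m + y) / real n))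
      \<longlonglongrightarrow> (LINT y|lborel. tent y *\<^sub>R l)"
  proof (rule integral_dominated_convergence)
    show "integrable lborel (\<lambda>y. \<bar>tent y\<bar> * M)"
      using integrable_tent by auto
    show "AE y in lborel. (\<lambda>n. tent y *\<^sub>R F (c + (m + y) / real n)) \<longlonglongrightarrow> tent y *\<^sub>R l"
    proof (intro AE_I2)
      fix y show "(\<lambda>n. tent y *\<^sub>R F (c + (m + y) / real n)) \<longlonglongrightarrow> tent y *\<^sub>R l"
      \<comment> \<open>Outside (0, 2) the tent vanishes, so convergence of \<open>F\<close> matters
        only in the open interval. This permits one-sided limits.\<close>
      proof (cases "0 < y \<and> y < 2")
        case True
        then show ?thesis by (auto intro!: tendsto_scaleR lim)
      qed (simp add: tent_eq_0)
    qed
    show "AE y in lborel. norm (tent y *\<^sub>R F (c + (m + y) / real n)) \<le> \<bar>tent y\<bar> * M" for n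
      by (auto intro!: mult_left_mono bounded)
  qed auto
  moreover have "(LINT y|lborel. tent y *\<^sub>R l) = l"
    by (simp add: integrable_tent integral_tent)
  moreover have "\<forall>\<^sub>F n in sequentially. (LINT y|lborel. tent y *\<^sub>R F (c + (m + y) / real n))
      = (LINT x|lborel. (real n * tent (real n * (x - c) - m)) *\<^sub>R F x)"
    using eventually_gt_at_top[of 0]
  proof eventually_elim
    case (elim n)
    have "(LINT x|lborel. (real n * tent (real n * (x - c) - m)) *\<^sub>R F x)
       = (1 / n) *\<^sub>R (LINT y|lborel. (real n * tent (real n * ((c + m / n) + 1 / n * y - c) - m)) *\<^sub>R
             F ((c + m / n) + 1 / n * y))"
      using elim by (subst lborel_integral_real_affine[where c="1 / real n" and t="c + m / n"]) auto
    also have "\<dots> = (1 / n) *\<^sub>R (LINT y|lborel. real n *\<^sub>R (tent y *\<^sub>R F (c + (m + y) / n)))"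
      using elim by (simp add: field_simps)
    also have "\<dots> = (LINT y|lborel. tent y *\<^sub>R F (c + (m + y) / n))"
      using elim by (subst integral_scaleR_right) simp
    finally show ?case by simp
  qed
  ultimately show ?thesis
    by (simp add: Lim_transform_eventually)
qed

text \<open>Testing against a \<open>C\<^sup>1\<close> approximation of the indicator of \<open>(a, t)\<close>.\<close>

lemma weak_deriv_FTC:
  fixes u :: "real \<Rightarrow> 'a::euclidean_space"
  assumes wd: "has_weak_deriv a b u v" and cont: "continuous_on {a..b} u" and t: "a < t" "t \<le> b"
  shows "u t = u a + (LINT x:{a<..<t}|lborel. v x)"
proof -
  \<comment> \<open>The shifts 1 and -3 make \<open>\<phi> n\<close> rise on [a + 1/n, a + 3/n] and
    fall on [t - 3/n, t - 1/n], which keeps its support off the endpoints. The form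
    \<open>- (-3)\<close> matches the parameter \<open>m\<close> of
    \<open>tent_approximate_identity\<close>.\<close>
  define \<phi> where "\<phi> = (\<lambda>n::nat. \<lambda>x. smooth_step (real n * (x - a) - 1) - smooth_step (real n * (x - t) - (-3)))"
  define \<phi>' where "\<phi>' = (\<lambda>n::nat. \<lambda>x. real n * tent (real n * (x - a) - 1) - real n * tent (real n * (x - t) - (-3)))"
  define U where "U = (\<lambda>x. indicator {a..b} x *\<^sub>R u x)"
  have U [measurable]: "integrable lborel U" "U \<in> borel_measurable borel"
    using wd borel_measurable_integrable by (auto simp: has_weak_deriv_def set_integrable_def U_def)
  have V: "integrable lborel (\<lambda>x. indicator {a..b} x *\<^sub>R v x)"
    using wd by (auto simp: has_weak_deriv_def set_integrable_def)
  note V' [measurable] = borel_measurable_integrable[OF V]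
  have deriv: "(\<phi> n has_real_derivative \<phi>' n x) (at x)" for n x
    unfolding \<phi>_def \<phi>'_def
    by (auto intro!: derivative_eq_intros DERIV_chain2[OF has_real_derivative_smooth_step])
  obtain M where "\<forall>y\<in>u ` {a..b}. norm y \<le> M"
    using compact_imp_bounded[OF compact_continuous_image[OF cont compact_Icc]]
    unfolding bounded_iff ..
  then have M: "norm (u x) \<le> M" if "x \<in> {a..b}" for x
    using that by blast
  have "0 \<le> M" using order_trans[OF norm_ge_zero M[of a]] t by simp
  have boundU: "norm (U x) \<le> M" for x
    using M[of x] \<open>0 \<le> M\<close> by (auto simp: U_def indicator_def)
  \<comment> \<open>The two scaled tents in \<open>\<phi>' n\<close> average \<open>u\<close> near
    \<open>a\<close> and near \<open>t\<close>. \<open>U\<close> extends \<open>u\<close> by 0, so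
    the averaging points must eventually lie in [a, b] for continuity of \<open>u\<close> to
    apply.\<close>
  have lim_at: "(\<lambda>n. LINT x|lborel. (real n * tent (real n * (x - s) - m)) *\<^sub>R U x) \<longlonglongrightarrow> u s"
    if s: "s \<in> {a..b}" and ev: "\<And>y. 0 < y \<Longrightarrow> y < 2 \<Longrightarrow> \<forall>\<^sub>F n in sequentially. s + (m + y) / real n \<in> {a..b}"
    for s m
  proof (rule tent_approximate_identity)
    fix y :: real assume y: "0 < y" "y < 2"
    have "(\<lambda>n. s + (m + y) / real n) \<longlonglongrightarrow> s + 0"
      by (intro tendsto_intros lim_const_over_n)
    then have "(\<lambda>n. u (s + (m + y) / real n)) \<longlonglongrightarrow> u s"
      using continuous_on_tendsto_compose[OF cont _ s ev[OF y]] by simp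
    then show "(\<lambda>n. U (s + (m + y) / real n)) \<longlonglongrightarrow> u s"
      by (rule Lim_transform_eventually) (use ev[OF y] in eventually_elim, simp add: U_def)
  qed (use boundU in auto)
  have ev_small: "\<forall>\<^sub>F n in sequentially. \<bar>z / real n\<bar> < e" if "0 < e" for z e :: real
    using order_tendstoD(2)[OF tendsto_rabs_zero[OF lim_const_over_n[of z]] that] by simp
  have pos: "0 < t - a" "0 < b - a" using t by auto
  have lim_a: "(\<lambda>n. LINT x|lborel. (real n * tent (real n * (x - a) - 1)) *\<^sub>R U x) \<longlonglongrightarrow> u a"
  proof (rule lim_at)
    fix y :: real assume y: "0 < y" "y < 2"
    show "\<forall>\<^sub>F n in sequentially. a + (1 + y) / real n \<in> {a..b}"
      using ev_small[OF pos(2), of "1 + y"]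
      by eventually_elim (use y in \<open>auto simp: abs_less_iff\<close>)
  qed (use t in auto)
  \<comment> \<open>Here the averaging points approach \<open>t\<close> from the left, as
    \<open>-3 + y\<close> is negative for \<open>y < 2\<close>; so \<open>t = b\<close> is
    covered.\<close>
  have lim_t: "(\<lambda>n. LINT x|lborel. (real n * tent (real n * (x - t) - (-3))) *\<^sub>R U x) \<longlonglongrightarrow> u t"
  proof (rule lim_at)
    fix y :: real assume y: "0 < y" "y < 2"
    show "\<forall>\<^sub>F n in sequentially. t + (-3 + y) / real n \<in> {a..b}"
      using ev_small[OF pos(1), of "-3 + y"]
    proof (eventually_elim, goal_cases)
      case (1 n)
      moreover note t
      moreover have "(-3 + y) / real n \<le> 0"
        using y by (intro divide_nonpos_nonneg) auto
      ultimately show ?case unfolding atLeastAtMost_iff by linarith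
    qed
  qed (use t in auto)
  have int_tent: "integrable lborel (\<lambda>x. (real n * tent (real n * (x - s) - m)) *\<^sub>R U x)" for n s m
  proof (rule Bochner_Integration.integrable_bound)
    show "integrable lborel (\<lambda>x. real n * norm (U x))" using U by auto
    have "\<bar>tent z\<bar> \<le> 1" for z
      by (rule order_trans[OF abs_tent_le]) (simp split: split_indicator)
    then show "AE x in lborel. norm ((real n * tent (real n * (x - s) - m)) *\<^sub>R U x) \<le> norm (real n * norm (U x))"
      by (auto simp: abs_mult intro!: mult_right_mono mult_left_le)
  qed auto
  have lhs: "(\<lambda>n. LINT x:{a..b}|lborel. deriv (\<phi> n) x *\<^sub>R u x) \<longlonglongrightarrow> u a - u t"
  proof -
    have "(LINT x:{a..b}|lborel. deriv (\<phi> n) x *\<^sub>R u x) =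
      (LINT x|lborel. (real n * tent (real n * (x - a) - 1)) *\<^sub>R U x)
      - (LINT x|lborel. (real n * tent (real n * (x - t) - (-3))) *\<^sub>R U x)" for n
    proof -
      have "indicator {a..b} x *\<^sub>R deriv (\<phi> n) x *\<^sub>R u x =
          (real n * tent (real n * (x - a) - 1)) *\<^sub>R U x - (real n * tent (real n * (x - t) - (-3))) *\<^sub>R U x" for x
        unfolding DERIV_imp_deriv[OF deriv] \<phi>'_def U_def scaleR_left_diff_distrib[symmetric]
        by (simp only: scaleR_scaleR mult.commute)
      then show ?thesis
        unfolding set_lebesgue_integral_def
        by (simp only: Bochner_Integration.integral_diff[OF int_tent int_tent])
    qed
    then show ?thesis using tendsto_diff[OF lim_a lim_t] by simp
  qed
  \<comment> \<open>Dominated convergence: the cutoffs are bounded by 1 in absolute value and tend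
    pointwise to the indicator of the open interval (a, t).\<close>
  have "(\<lambda>n. LINT x:{a..b}|lborel. \<phi> n x *\<^sub>R v x) \<longlonglongrightarrow> (LINT x:{a<..<t}|lborel. v x)"
    unfolding set_lebesgue_integral_def
  proof (rule integral_dominated_convergence)
    show "integrable lborel (\<lambda>x. norm (indicator {a..b} x *\<^sub>R v x))" using V by (rule integrable_norm)
    \<comment> \<open>Only the restriction of \<open>v\<close> to [a, b] is known to be measurable,
      so the indicator of the larger interval is inserted first.\<close>
    have "(\<lambda>x. indicator {a<..<t} x *\<^sub>R indicator {a..b} x *\<^sub>R v x) \<in> borel_measurable lborel"
      by (intro borel_measurable_scaleR V') auto
    also have "(\<lambda>x. indicator {a<..<t} x *\<^sub>R indicator {a..b} x *\<^sub>R v x) = (\<lambda>x. indicator {a<..<t} x *\<^sub>R v x)"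
      using t by (auto simp: indicator_def fun_eq_iff)
    finally show "(\<lambda>x. indicator {a<..<t} x *\<^sub>R v x) \<in> borel_measurable lborel" .
    have phi [measurable]: "\<phi> n \<in> borel_measurable borel" for n
      by (intro borel_measurable_continuous_onI DERIV_continuous_on[OF has_field_derivative_at_within[OF deriv]])
    show "(\<lambda>x. indicator {a..b} x *\<^sub>R \<phi> n x *\<^sub>R v x) \<in> borel_measurable lborel" for n
    proof -
      have "(\<lambda>x. \<phi> n x *\<^sub>R indicator {a..b} x *\<^sub>R v x) \<in> borel_measurable lborel"
        by (intro borel_measurable_scaleR V') (simp add: phi)
      then show ?thesis by (simp add: mult.commute)
    qed
    show "AE x in lborel. norm (indicator {a..b} x *\<^sub>R \<phi> n x *\<^sub>R v x) \<le> norm (indicator {a..b} x *\<^sub>R v x)" for n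
    proof (intro AE_I2)
      fix x
      have "\<bar>\<phi> n x\<bar> \<le> 1"
        using smooth_step_bounds[of "real n * (x - a) - 1"] smooth_step_bounds[of "real n * (x - t) - (-3)"]
        by (auto simp: \<phi>_def)
      then show "norm (indicator {a..b} x *\<^sub>R \<phi> n x *\<^sub>R v x) \<le> norm (indicator {a..b} x *\<^sub>R v x)"
        by (auto simp: indicator_def mult_left_le_one_le)
    qed
    have step0: "(\<lambda>n. smooth_step (real n * (x - s) - m)) \<longlonglongrightarrow> 0" if "x < s" for x s m
    proof (rule tendsto_eventually)
      show "\<forall>\<^sub>F n in sequentially. smooth_step (real n * (x - s) - m) = 0"
        using ev_small[of "s - x" "m", simplified, OF that] eventually_gt_at_top[of 0]
        by eventually_elim (auto intro!: smooth_step_le_0 simp: field_simps abs_less_iff)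
    qed
    have step1: "(\<lambda>n. smooth_step (real n * (x - s) - m)) \<longlonglongrightarrow> 1" if "s < x" for x s m
    proof (rule tendsto_eventually)
      show "\<forall>\<^sub>F n in sequentially. smooth_step (real n * (x - s) - m) = 1"
        using ev_small[of "x - s" "m + 2", simplified, OF that] eventually_gt_at_top[of 0]
        by eventually_elim (auto intro!: smooth_step_ge_2 simp: field_simps abs_less_iff)
    qed
    have "(\<lambda>n. \<phi> n x) \<longlonglongrightarrow> (if a < x \<and> x < t then 1 else 0)" for x
    proof -
      consider "x < a" | "x = a" | "a < x" "x < t" | "x = t" | "t < x" by linarith
      then show ?thesis
      proof cases
        case 1 then show ?thesis
          unfolding \<phi>_def using t tendsto_diff[OF step0[of x a 1] step0[of x t "-3"]] by simp
      next
        \<comment> \<open>At \<open>x = a\<close> the first step has the constant argument -1; at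
          \<open>x = t\<close>, below, the second has the constant argument 3. Both lie where
          \<open>smooth_step\<close> is flat.\<close>
        case 2 then show ?thesis
          unfolding \<phi>_def using t tendsto_diff[OF tendsto_const[of "0::real"] step0[of x t "-3"]] by (simp add: smooth_step_le_0)
      next
        case 3 then show ?thesis
          unfolding \<phi>_def using t tendsto_diff[OF step1[of a x 1] step0[of x t "-3"]] by simp
      next
        case 4 then show ?thesis
          unfolding \<phi>_def using t tendsto_diff[OF step1[of a x 1] tendsto_const[of "1::real"]] by (simp add: smooth_step_ge_2)
      next
        case 5 then show ?thesis
          unfolding \<phi>_def using t tendsto_diff[OF step1[of a x 1] step1[of t x "-3"]] by simp
      qed
    qed
    then show "AE x in lborel. (\<lambda>n. indicator {a..b} x *\<^sub>R \<phi> n x *\<^sub>R v x) \<longlonglongrightarrow> indicator {a<..<t} x *\<^sub>R v x"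
    proof (intro AE_I2)
      fix x
      assume *: "\<And>x. (\<lambda>n. \<phi> n x) \<longlonglongrightarrow> (if a < x \<and> x < t then 1 else 0)"
      have "(\<lambda>n. indicator {a..b} x *\<^sub>R \<phi> n x *\<^sub>R v x) \<longlonglongrightarrow>
          indicator {a..b} x *\<^sub>R (if a < x \<and> x < t then 1 else 0) *\<^sub>R v x"
        by (intro tendsto_intros *)
      also have "indicator {a..b} x *\<^sub>R (if a < x \<and> x < t then 1 else 0) *\<^sub>R v x = indicator {a<..<t} x *\<^sub>R v x"
        using t by (auto simp: indicator_def)
      finally show "(\<lambda>n. indicator {a..b} x *\<^sub>R \<phi> n x *\<^sub>R v x) \<longlonglongrightarrow> indicator {a<..<t} x *\<^sub>R v x" .
    qed
  qed
  then have rhs: "(\<lambda>n. - (LINT x:{a..b}|lborel. \<phi> n x *\<^sub>R v x)) \<longlonglongrightarrow> - (LINT x:{a<..<t}|lborel. v x)"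
    by (rule tendsto_minus)
  \<comment> \<open>The threshold 4 = 1 + 3 comes from the shifts: once \<open>n * (t - a)\<close>
    exceeds it, outside [a + 1/n, t - 1/n] both steps are 0 or both are 1, so
    \<open>\<phi> n\<close> is an admissible test function.\<close>
  have "\<forall>\<^sub>F n in sequentially. (LINT x:{a..b}|lborel. deriv (\<phi> n) x *\<^sub>R u x) = - (LINT x:{a..b}|lborel. \<phi> n x *\<^sub>R v x)"
    using ev_small[OF pos(1), of 4] eventually_gt_at_top[of 0]
  proof eventually_elim
    case (elim n)
    have n: "0 < real n" "4 < real n * (t - a)" using elim t by (auto simp: field_simps)
    have "{x. \<phi> n x \<noteq> 0} \<subseteq> {a + 1 / n..t - 1 / n}"
    proof (rule subsetI, rule ccontr)
      fix x assume x: "x \<in> {x. \<phi> n x \<noteq> 0}" "x \<notin> {a + 1 / n..t - 1 / n}"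
      from x(2) have "x < a + 1 / n \<or> t - 1 / n < x" by auto
      then show False
      proof
        assume "x < a + 1 / n"
        then have "real n * (x - a) < 1" using n by (simp add: field_simps)
        moreover have "real n * (x - t) = real n * (x - a) - real n * (t - a)" by (simp add: algebra_simps)
        ultimately have "real n * (x - a) - 1 \<le> 0" "real n * (x - t) - (-3) \<le> 0" using n by linarith+
        then show False using x by (simp add: \<phi>_def smooth_step_le_0)
      next
        assume "t - 1 / n < x"
        then have "real n * (x - t) > -1" using n by (simp add: field_simps)
        moreover have "real n * (x - a) = real n * (x - t) + real n * (t - a)" by (simp add: algebra_simps)
        ultimately have "real n * (x - a) - 1 \<ge> 2" "real n * (x - t) - (-3) \<ge> 2" using n by linarith+
        then show False using x by (simp add: \<phi>_def smooth_step_ge_2)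
      qed
    qed
    then have cl: "closure {x. \<phi> n x \<noteq> 0} \<subseteq> {a + 1 / n..t - 1 / n}"
      by (rule closure_minimal) auto
    moreover have "{a + 1 / n..t - 1 / n} \<subseteq> {a<..<b}"
    proof 
      fix x assume "x \<in> {a + 1 / n..t - 1 / n}"
      moreover have "1 / real n > 0" using n by simp
      ultimately show "x \<in> {a<..<b}" using t
        unfolding greaterThanLessThan_iff atLeastAtMost_iff by linarith
    qed
    moreover have "compact (closure {x. \<phi> n x \<noteq> 0})"
      using cl by (auto simp: compact_eq_bounded_closed intro: bounded_subset[OF bounded_closed_interval])
    moreover have "\<phi> n C1_differentiable_on UNIV"
      unfolding C1_differentiable_on_def
    proof (intro exI conjI ballI)
      show "(\<phi> n has_vector_derivative \<phi>' n x) (at x)" for x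
        using deriv by (simp add: has_real_derivative_iff_has_vector_derivative)
      show "continuous_on UNIV (\<phi>' n)"
        unfolding \<phi>'_def tent_def by (intro continuous_intros) auto
    qed
    ultimately have "test_fun a b (\<phi> n)" by (auto simp: test_fun_def)
    then show ?case using wd by (simp add: has_weak_deriv_def)
  qed
  then have "(\<lambda>n. - (LINT x:{a..b}|lborel. \<phi> n x *\<^sub>R v x)) \<longlonglongrightarrow> u a - u t"
    using lhs by (rule Lim_transform_eventually[rotated])
  from LIMSEQ_unique[OF this rhs] show ?thesis by (simp add: algebra_simps)
qed

section \<open>An elementary power inequality used in place of Hoelder's inequality\<close>

text \<open>If \<open>s\<close> exceeds \<open>l\<close>, then
  \<open>s = s powr (1 - p) * s powr p\<close>, and the negative exponent \<open>1 - p\<close>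
  allows \<open>l\<close> to replace \<open>s\<close> in the first factor. The free parameter
  \<open>l\<close> is tuned after integration.\<close>

lemma norm_le_scaled_powr:
  fixes s l p :: real
  assumes "0 \<le> s" "0 < l" "1 < p"
  shows "s \<le> l + l powr (1 - p) * s powr p"
proof (cases "s \<le> l")
  case True
  moreover have "0 \<le> l powr (1 - p) * s powr p" by simp
  ultimately show ?thesis by linarith
next
  case False
  then have "0 < s" using assms by simp
  then have "s = s powr (1 - p) * s powr p"
    by (simp flip: powr_add)
  also have "\<dots> \<le> l powr (1 - p) * s powr p"
    using assms False by (intro mult_right_mono powr_mono2') auto
  finally show ?thesis using assms by linarith
qed

text \<open>The choice \<open>l = (1 + h) powr (1/p)\<close> optimises the previous bound after integration, which makes
  Hoelder's inequality unnecessary.\<close>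

lemma scaled_powr_le:
  fixes h p K :: real
  assumes "0 \<le> h" "1 < p"
  shows "K * (1 + h) powr (1/p) + ((1 + h) powr (1/p)) powr (1 - p) * h \<le> (K + 1) * (1 + h) powr (1/p)"
proof -
  have "((1 + h) powr (1/p)) powr (1 - p) * h \<le> ((1 + h) powr (1/p)) powr (1 - p) * (1 + h)"
    using assms by (intro mult_left_mono) auto
  also have "\<dots> = ((1 + h) powr (1/p)) powr (1 - p) * ((1 + h) powr (1/p)) powr p"
    using assms by (simp add: powr_powr)
  also have "\<dots> = (1 + h) powr (1/p)"
    using assms by (simp flip: powr_add)
  finally show ?thesis by (simp add: algebra_simps)
qed

section \<open>Fractional kernels and convolutions\<close>

text \<open>The Riemann-Liouville kernel without the Gamma factor, cut off to [0, T]: it becomes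
  integrable on the whole line, so fractional integrals on an interval of length \<open>T\<close>
  are dominated by convolutions over the real line.\<close>

definition frac_kernel :: "real \<Rightarrow> real \<Rightarrow> real \<Rightarrow> real" where
  "frac_kernel T \<beta> s = indicator {0..T} s * s powr (\<beta> - 1)"

lemma frac_kernel_measurable [measurable]: "frac_kernel T \<beta> \<in> borel_measurable borel"
  unfolding frac_kernel_def by measurable

lemma frac_kernel_nonneg [simp]: "0 \<le> frac_kernel T \<beta> s"
  by (simp add: frac_kernel_def)

lemma has_bochner_integral_frac_kernel:
  assumes "0 \<le> T" "0 < \<beta>"
  shows "has_bochner_integral lborel (frac_kernel T \<beta>) (T powr \<beta> / \<beta>)"
proof (rule has_bochner_integral_nn_integral)
  have "((\<lambda>x. x powr (\<beta> - 1)) has_integral (T powr \<beta> / \<beta>)) {0..T}"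
    using has_integral_powr_from_0[of "\<beta> - 1" T] assms by simp
  from nn_integral_has_integral_lebesgue'[OF _ this]
  show "(\<integral>\<^sup>+ x. ennreal (frac_kernel T \<beta> x) \<partial>lborel) = ennreal (T powr \<beta> / \<beta>)"
    by (simp add: frac_kernel_def ennreal_mult' mult.commute ennreal_indicator)
qed (use assms in auto)

text \<open>For \<open>y\<close> in [a, t] the difference \<open>t - y\<close> lies in [0, T], where
  the cutoff kernel is the true one. A nonintegrable integrand has integral 0 by convention, which
  is consistent with both estimates, so \<open>f\<close> enters only through its pointwise
  bound.\<close>

lemma norm_RL_integral_le:
  fixes f :: "real \<Rightarrow> 'a::euclidean_space"
  assumes "0 < \<beta>" "t - a \<le> T"
    and f: "\<And>y. y \<in> {a..t} \<Longrightarrow> norm (f y) \<le> G y" and G: "\<And>y. 0 \<le> G y"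
    and int: "integrable lborel (\<lambda>y. frac_kernel T \<beta> (t - y) * G y)"
  shows "norm (RL_integral a \<beta> f t) \<le> (LINT y|lborel. frac_kernel T \<beta> (t - y) * G y) / Gamma \<beta>"
proof -
  have "norm (LINT y:{a..t}|lborel. (t - y) powr (\<beta> - 1) *\<^sub>R f y)
      \<le> (LINT y|lborel. norm (indicator {a..t} y *\<^sub>R (t - y) powr (\<beta> - 1) *\<^sub>R f y))"
    unfolding set_lebesgue_integral_def by (rule integral_norm_bound)
  also have "\<dots> \<le> (LINT y|lborel. frac_kernel T \<beta> (t - y) * G y)"
  proof (rule integral_mono'[OF int])
    show "norm (indicator {a..t} y *\<^sub>R (t - y) powr (\<beta> - 1) *\<^sub>R f y) \<le> frac_kernel T \<beta> (t - y) * G y" for y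
      using assms(2) G[of y] f[of y]
      by (auto simp: frac_kernel_def split: split_indicator intro!: mult_left_mono)
  qed (use G in auto)
  finally show ?thesis
    using Gamma_real_pos[OF assms(1)] by (simp add: RL_integral_def divide_right_mono)
qed

text \<open>By translation invariance, integrating over \<open>t\<close> first gives
  \<open>K * g y\<close>, which is integrable in \<open>y\<close>. Nonnegativity turns this into
  absolute integrability on the product, and Fubini's theorem exchanges the order.\<close>

lemma convolution_integrable:
  fixes k g :: "real \<Rightarrow> real"
  assumes k: "has_bochner_integral lborel k K" and g: "has_bochner_integral lborel g A"
    and "\<And>x. 0 \<le> k x" "\<And>x. 0 \<le> g x"
  shows "AE t in lborel. integrable lborel (\<lambda>y. k (t - y) * g y)"
    and "has_bochner_integral lborel (\<lambda>t. LINT y|lborel. k (t - y) * g y) (K * A)"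
proof -
  have [measurable]: "k \<in> borel_measurable borel" "g \<in> borel_measurable borel"
    using k g by (auto simp: has_bochner_integral_iff dest: borel_measurable_integrable)
  have shift: "has_bochner_integral lborel (\<lambda>t. k (t - y) * g y) (K * g y)" for y
    using lborel_has_bochner_integral_real_affine_iff[of 1 k K "- y"] k
    by (intro has_bochner_integral_mult_left) simp
  interpret lborel_pair: pair_sigma_finite lborel lborel ..
  have "integrable (lborel \<Otimes>\<^sub>M lborel) (\<lambda>(y, t). k (t - y) * g y)"
  proof (rule lborel_pair.Fubini_integrable)
    have "(\<lambda>y. LINT t|lborel. norm (case (y, t) of (y, t) \<Rightarrow> k (t - y) * g y)) = (\<lambda>y. K * g y)"
      using has_bochner_integral_integral_eq[OF shift] assms(3,4) by (simp del: integral_mult_left integral_mult_left_zero)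
    then show "integrable lborel (\<lambda>y. LINT t|lborel. norm (case (y, t) of (y, t) \<Rightarrow> k (t - y) * g y))"
      using g by (simp add: has_bochner_integral_iff)
    show "AE y in lborel. integrable lborel (\<lambda>t. case (y, t) of (y, t) \<Rightarrow> k (t - y) * g y)"
      using shift by (simp add: has_bochner_integral_iff)
  qed simp
  note I = this
  show "AE t in lborel. integrable lborel (\<lambda>y. k (t - y) * g y)"
    using lborel_pair.AE_integrable_snd[OF I] .
  have "(LINT t|lborel. LINT y|lborel. k (t - y) * g y) = (LINT y|lborel. LINT t|lborel. k (t - y) * g y)"
    using lborel_pair.Fubini_integral[OF I] .
  also have "\<dots> = K * A"
    using has_bochner_integral_integral_eq[OF shift] has_bochner_integral_integral_eq[OF g]
    by (simp del: integral_mult_left integral_mult_left_zero)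
  finally show "has_bochner_integral lborel (\<lambda>t. LINT y|lborel. k (t - y) * g y) (K * A)"
    using lborel_pair.integrable_snd[OF I] by (simp add: has_bochner_integral_iff)
qed

section \<open>Absorption of terms of lower degree\<close>

lemma powr_absorb_lower_order:
  fixes s p e :: real
  assumes "s < p" "0 < e"
  shows "\<exists>C\<ge>0. \<forall>m\<ge>1. m powr s \<le> e * m powr p + C"
proof -
  \<comment> \<open>\<open>m0\<close> solves \<open>e * m0 powr (p - s) = 1\<close>: above it the
    leading term dominates, below it a constant suffices. The constant uses
    \<open>\<bar>s\<bar>\<close> because \<open>s\<close> may be negative.\<close>
  define m0 where "m0 = (1 / e) powr (1 / (p - s))"
  have "m powr s \<le> e * m powr p + max 1 (m0 powr \<bar>s\<bar>)" if "1 \<le> m" for m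
  proof (cases "m \<le> m0")
    case True
    have "m powr s \<le> m powr \<bar>s\<bar>" using that by (intro powr_mono) auto
    also have "\<dots> \<le> m0 powr \<bar>s\<bar>" using that True by (intro powr_mono2) auto
    finally show ?thesis using assms by (simp add: add_increasing le_max_iff_disj)
  next
    case False
    have "1 / e = m0 powr (p - s)" using assms by (simp add: m0_def powr_powr)
    also have "\<dots> \<le> m powr (p - s)"
      using False assms by (intro powr_mono2) (auto simp: m0_def)
    finally have "1 \<le> e * m powr (p - s)" using assms by (simp add: field_simps)
    then have "1 * m powr s \<le> (e * m powr (p - s)) * m powr s"
      by (intro mult_right_mono) auto
    also have "\<dots> = e * m powr p" by (simp add: mult.assoc flip: powr_add)
    finally show ?thesis by (simp add: add_increasing2)
  qed
  then show ?thesis by (intro exI[of _ "max 1 (m0 powr \<bar>s\<bar>)"]) auto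
qed

text \<open>The sum is at most five times its largest term, and the power of that term is one of the
  summands on the right. This avoids convexity and works for every nonnegative
  \<open>p\<close>.\<close>

lemma powr_sum5_le:
  fixes p :: real
  assumes "0 \<le> p" "0 \<le> n1" "0 \<le> n2" "0 \<le> n3" "0 \<le> n4"
  shows "(1 + n1 + n2 + n3 + n4) powr p
    \<le> 5 powr p * (1 + n1 powr p + n2 powr p + n3 powr p + n4 powr p)"
proof -
  define M where "M = Max {1, n1, n2, n3, n4}"
  have M: "1 \<le> M" "n1 \<le> M" "n2 \<le> M" "n3 \<le> M" "n4 \<le> M" 
    by (auto simp: M_def)
  have "M \<in> {1, n1, n2, n3, n4}"
    unfolding M_def by (rule Max_in) auto
  then have "M powr p \<le> 1 + n1 powr p + n2 powr p + n3 powr p + n4 powr p"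
    by (auto simp: add_increasing add_increasing2)
  moreover have "(1 + n1 + n2 + n3 + n4) powr p \<le> (5 * M) powr p"
    using assms M by (intro powr_mono2) auto
  ultimately show ?thesis
    using M by (simp add: powr_mult) (meson mult_left_mono order_trans powr_ge_zero)
qed

lemma rpow_nonneg: "0 \<le> rpow s e"
  by (simp add: rpow_def)

lemma rpow_le_powr: "rpow s e \<le> m powr e" if "0 \<le> s" "s \<le> m" "1 \<le> m" "0 \<le> e"
  using that by (auto simp: rpow_def intro: powr_mono2)

text \<open>With \<open>m = 1 + n1 + n2 + n3 + n4\<close>, every product of powers is at most
  \<open>m\<close> raised to its total degree. That degree is below \<open>p\<close>, so a small
  multiple of \<open>m powr p\<close> plus a constant absorbs it, whatever the sign of
  \<open>c k\<close>.\<close>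

lemma mixed_power_sum_lower_bound:
  fixes c d1 d2 d3 d4 :: "nat \<Rightarrow> real"
  assumes d: "\<forall>k\<in>{1..N}. d1 k \<ge> 0 \<and> d2 k \<ge> 0 \<and> d3 k \<ge> 0 \<and> d4 k \<ge> 0"
    and deg: "\<forall>k\<in>{1..N}. d1 k + d2 k + d3 k + d4 k < p"
    and "0 < p" "0 < e"
  shows "\<exists>C\<ge>0. \<forall>n1\<ge>0. \<forall>n2\<ge>0. \<forall>n3\<ge>0. \<forall>n4\<ge>0.
    (\<Sum>k=1..N. c k * rpow n1 (d1 k) * rpow n2 (d2 k) * rpow n3 (d3 k) * rpow n4 (d4 k))
      \<ge> - e * (n1 powr p + n2 powr p + n3 powr p + n4 powr p) - C"
proof -
  define S where "S = (\<Sum>k=1..N. \<bar>c k\<bar>)"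
  \<comment> \<open>Chosen so that \<open>(S + 1) * e' * 5 powr p = e\<close>, where
    \<open>5 powr p\<close> is the loss in \<open>powr_sum5_le\<close>; \<open>S + 1\<close> keeps
    the denominator positive.\<close>
  define e' where "e' = e / (5 powr p * (S + 1))"
  have S: "0 \<le> S" by (auto simp: S_def intro: sum_nonneg)
  have "0 < e'" using \<open>0 < e\<close> S by (simp add: e'_def)
  then have "\<forall>k\<in>{1..N}. \<exists>C\<ge>0. \<forall>m\<ge>1. m powr (d1 k + d2 k + d3 k + d4 k) \<le> e' * m powr p + C"
    using powr_absorb_lower_order deg by blast
  then obtain C where C: "\<And>k. k \<in> {1..N} \<Longrightarrow> 0 \<le> C k"
    "\<And>k m. k \<in> {1..N} \<Longrightarrow> 1 \<le> m \<Longrightarrow> m powr (d1 k + d2 k + d3 k + d4 k) \<le> e' * m powr p + C k"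
    by metis
  define D where "D = (\<Sum>k=1..N. \<bar>c k\<bar> * C k)"
  \<comment> \<open>In the constant \<open>e + D\<close>, the part \<open>e\<close> pays for the
    summand 1 inside \<open>m\<close>, and \<open>D\<close> collects the absorption
    constants.\<close>
  have "- e * (n1 powr p + n2 powr p + n3 powr p + n4 powr p) - (e + D) \<le>
      (\<Sum>k=1..N. c k * rpow n1 (d1 k) * rpow n2 (d2 k) * rpow n3 (d3 k) * rpow n4 (d4 k))"
    if n: "0 \<le> n1" "0 \<le> n2" "0 \<le> n3" "0 \<le> n4" for n1 n2 n3 n4
  proof -
    define m where "m = 1 + n1 + n2 + n3 + n4"
    have m: "1 \<le> m" "n1 \<le> m" "n2 \<le> m" "n3 \<le> m" "n4 \<le> m" using n by (auto simp: m_def)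
    have term_le: "- (\<bar>c k\<bar> * (e' * m powr p + C k)) \<le>
        c k * rpow n1 (d1 k) * rpow n2 (d2 k) * rpow n3 (d3 k) * rpow n4 (d4 k)" if k: "k \<in> {1..N}" for k
    proof -
      define R where "R = rpow n1 (d1 k) * rpow n2 (d2 k) * rpow n3 (d3 k) * rpow n4 (d4 k)"
      have "R \<le> m powr d1 k * m powr d2 k * m powr d3 k * m powr d4 k"
        unfolding R_def using k d n m
        by (intro mult_mono mult_nonneg_nonneg rpow_le_powr rpow_nonneg) auto
      also have "\<dots> = m powr (d1 k + d2 k + d3 k + d4 k)" by (simp add: powr_add)
      also have "\<dots> \<le> e' * m powr p + C k" using C(2)[OF k m(1)] .
      finally have "\<bar>c k\<bar> * R \<le> \<bar>c k\<bar> * (e' * m powr p + C k)" by (intro mult_left_mono) auto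
      moreover have "0 \<le> R" by (simp add: R_def rpow_nonneg)
      then have "- (\<bar>c k\<bar> * R) \<le> c k * R"
        using mult_right_mono[of "- \<bar>c k\<bar>" "c k" R] by simp
      ultimately show ?thesis by (simp add: R_def mult.assoc)
    qed
    have "S * e' * m powr p \<le> (S + 1) * e' * m powr p"
      using \<open>0 < e'\<close> by (intro mult_right_mono) auto
    also have "\<dots> \<le> (S + 1) * e' * (5 powr p * (1 + n1 powr p + n2 powr p + n3 powr p + n4 powr p))"
      unfolding m_def using powr_sum5_le[of p n1 n2 n3 n4] n \<open>0 < e'\<close> S \<open>0 < p\<close>
      by (intro mult_left_mono) auto
    also have "\<dots> = e * (1 + n1 powr p + n2 powr p + n3 powr p + n4 powr p)"
    proof -
      have "(S + 1) * e' * 5 powr p = e" using S by (simp add: e'_def)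
      then show ?thesis by (metis mult.assoc)
    qed
    finally have "- e * (n1 powr p + n2 powr p + n3 powr p + n4 powr p) - (e + D) \<le> - (S * e' * m powr p) - D"
      by (simp add: algebra_simps)
    also have "\<dots> = (\<Sum>k=1..N. - (\<bar>c k\<bar> * (e' * m powr p + C k)))"
      by (simp add: D_def S_def sum_negf sum_subtractf sum.distrib sum_distrib_right distrib_left mult.assoc)
    also have "\<dots> \<le> (\<Sum>k=1..N. c k * rpow n1 (d1 k) * rpow n2 (d2 k) * rpow n3 (d3 k) * rpow n4 (d4 k))"
      using term_le by (rule sum_mono)
    finally show ?thesis .
  qed
  moreover have "0 \<le> D" unfolding D_def using C(1) by (intro sum_nonneg) auto
  ultimately show ?thesis using \<open>0 < e\<close> by (intro exI[of _ "e + D"]) auto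
qed

section \<open>A coercivity criterion and the Sobolev norm\<close>

lemma coercive_onI:
  assumes "0 < p" "0 < k" and "\<And>u. u \<in> E \<Longrightarrow> k * W1p_norm a b p u powr p - C \<le> F u"
  shows "coercive_on a b p E F"
  unfolding coercive_on_def
proof (rule filterlim_at_top_mono)
  \<comment> \<open>Growth of \<open>x powr p\<close> is read off from
    \<open>exp (p * ln x)\<close>, with which it agrees for positive \<open>x\<close>.\<close>
  have "filterlim (\<lambda>x. exp (p * ln x)) at_top (at_top :: real filter)"
    using \<open>0 < p\<close>
    by (intro filterlim_compose[OF exp_at_top] filterlim_tendsto_pos_mult_at_top[OF tendsto_const] ln_at_top)
  moreover have "\<forall>\<^sub>F x in at_top. exp (p * ln x) = x powr p"
    using eventually_gt_at_top[of 0] by eventually_elim (simp add: powr_def)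
  ultimately have "filterlim (\<lambda>x. x powr p) at_top at_top"
    using filterlim_cong[OF refl refl] by fast
  then have "filterlim (\<lambda>x. - C + k * x powr p) at_top at_top"
    using \<open>0 < k\<close>
    by (intro filterlim_tendsto_add_at_top[OF tendsto_const] filterlim_tendsto_pos_mult_at_top[OF tendsto_const])
  then have "filterlim (\<lambda>x. k * x powr p - C) at_top at_top"
    by (simp add: algebra_simps)
  then show "filterlim (\<lambda>u. k * W1p_norm a b p u powr p - C) at_top
      (inf (filtercomap (W1p_norm a b p) at_top) (principal E))"
    by (rule filterlim_compose) (rule filterlim_mono[OF filterlim_filtercomap order_refl inf_le1])
qed (use assms in \<open>auto simp: eventually_inf_principal\<close>)

text \<open>\<open>weak_deriv\<close> is picked by \<open>SOME\<close>; membership in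
  \<open>W1p\<close> supplies a witness, so the chosen function is a genuine weak
  derivative.\<close>

lemma W1pD:
  assumes "u \<in> W1p a b p"
  shows "has_weak_deriv a b u (weak_deriv a b u)" "continuous_on {a..b} u"
    "set_integrable lborel {a..b} (\<lambda>t. norm (u t) powr p)"
    "set_integrable lborel {a..b} (\<lambda>t. norm (weak_deriv a b u t) powr p)"
  using assms someI_ex[of "has_weak_deriv a b u"] by (auto simp: W1p_def weak_deriv_def in_Lp_def)

lemma Lp_norm_powr: "1 < p \<Longrightarrow> Lp_norm a b p f powr p = (LINT t:{a..b}|lborel. norm (f t) powr p)"
  by (simp add: Lp_norm_def powr_powr set_lebesgue_integral_def)

lemma W1p_norm_powr:
  "1 < p \<Longrightarrow> W1p_norm a b p u powr p =
    (LINT t:{a..b}|lborel. norm (u t) powr p) + (LINT t:{a..b}|lborel. norm (weak_deriv a b u t) powr p)"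
  unfolding W1p_norm_def Lp_norm_powr by (simp add: powr_powr set_lebesgue_integral_def)

section \<open>Estimates for Sobolev functions and their fractional integrals\<close>

text \<open>The increment of \<open>u\<close> is an integral of the weak derivative, and
  \<open>norm_le_scaled_powr\<close> with \<open>l = (1 + A) powr (1/p)\<close> bounds it by a
  multiple of \<open>l\<close>. Since \<open>l\<close> is at least 1, the initial value is absorbed
  as well.\<close>

lemma W1p_sup_bound:
  fixes u :: "real \<Rightarrow> 'a::euclidean_space"
  assumes "a < b" "1 < p" and u: "u \<in> W1p a b p" and t: "t \<in> {a..b}"
  defines "A \<equiv> LINT t:{a..b}|lborel. norm (weak_deriv a b u t) powr p"
  shows "norm (u t) \<le> (norm (u a) + (b - a + 1)) * (1 + A) powr (1/p)"
proof -
  define v where "v = weak_deriv a b u"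
  define l where "l = (1 + A) powr (1/p)"
  note W = W1pD[OF u, folded v_def]
  have A: "0 \<le> A" by (simp add: A_def set_lebesgue_integral_def)
  then have "1 \<le> l" using \<open>1 < p\<close> by (simp add: l_def ge_one_powr_ge_zero)
  have intv: "integrable lborel (\<lambda>x. indicator {a..b} x *\<^sub>R v x)"
    using W(1) by (simp add: has_weak_deriv_def set_integrable_def)
  have intp: "integrable lborel (\<lambda>x. indicator {a..b} x * norm (v x) powr p)"
    using W(4) by (simp add: set_integrable_def)
  have const: "has_bochner_integral lborel (\<lambda>x. indicator {a..b} x * l) ((b - a) * l)"
    using \<open>a < b\<close> has_bochner_integral_mult_left[OF has_bochner_integral_real_indicator[of "{a..b}" lborel], of l]
    by simp
  have "norm (u t - u a) \<le> (LINT x|lborel. norm (indicator {a..b} x *\<^sub>R v x))"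
  \<comment> \<open>\<open>weak_deriv_FTC\<close> requires \<open>a < t\<close>; at
    \<open>t = a\<close> the increment is 0.\<close>
  proof (cases "t = a")
    case False
    then have "u t - u a = (LINT x:{a<..<t}|lborel. v x)"
      using weak_deriv_FTC[OF W(1,2), of t] t by simp
    also have "norm \<dots> \<le> (LINT x|lborel. norm (indicator {a<..<t} x *\<^sub>R v x))"
      unfolding set_lebesgue_integral_def by (rule integral_norm_bound)
    also have "\<dots> \<le> (LINT x|lborel. norm (indicator {a..b} x *\<^sub>R v x))"
      using t by (intro integral_mono' integrable_norm[OF intv]) (auto split: split_indicator)
    finally show ?thesis .
  qed simp
  also have "\<dots> \<le> (LINT x|lborel. indicator {a..b} x * l + l powr (1 - p) * (indicator {a..b} x * norm (v x) powr p))"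
  proof (rule integral_mono')
    show "integrable lborel (\<lambda>x. indicator {a..b} x * l + l powr (1 - p) * (indicator {a..b} x * norm (v x) powr p))"
      using const intp by (intro Bochner_Integration.integrable_add integrable_mult_right) (auto simp: has_bochner_integral_iff)
    show "norm (indicator {a..b} x *\<^sub>R v x) \<le> indicator {a..b} x * l + l powr (1 - p) * (indicator {a..b} x * norm (v x) powr p)" for x
      using norm_le_scaled_powr[of "norm (v x)" l p] \<open>1 \<le> l\<close> \<open>1 < p\<close> by (auto split: split_indicator)
  qed (use \<open>1 \<le> l\<close> in auto)
  also have "\<dots> = (b - a) * l + l powr (1 - p) * A"
    using const intp by (subst Bochner_Integration.integral_add)
      (auto simp: has_bochner_integral_iff A_def v_def set_lebesgue_integral_def simp del: integral_indicator)
  also have "\<dots> \<le> (b - a + 1) * l"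
    using scaled_powr_le[OF A \<open>1 < p\<close>, of "b - a"] by (simp add: l_def)
  finally have "norm (u t - u a) \<le> (b - a + 1) * l" .
  moreover have "norm (u a) \<le> norm (u a) * l" using \<open>1 \<le> l\<close> by (simp add: mult_le_cancel_left1)
  moreover have "norm (u t) \<le> norm (u a) + norm (u t - u a)"
    using norm_triangle_ineq[of "u a" "u t - u a"] by simp
  ultimately show ?thesis by (simp add: l_def distrib_right)
qed

lemma RL_integral_bounded:
  fixes f :: "real \<Rightarrow> 'a::euclidean_space"
  assumes "a < b" "0 < \<beta>" "t \<in> {a..b}" and f: "\<And>y. y \<in> {a..b} \<Longrightarrow> norm (f y) \<le> M"
  shows "norm (RL_integral a \<beta> f t) \<le> (b - a) powr \<beta> / \<beta> / Gamma \<beta> * M"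
proof -
  define K where "K = (b - a) powr \<beta> / \<beta>"
  have "0 \<le> M" using order_trans[OF norm_ge_zero f[of a]] assms by simp
  have "has_bochner_integral lborel (frac_kernel (b - a) \<beta>) K"
    using has_bochner_integral_frac_kernel[of "b - a" \<beta>] assms by (simp add: K_def)
  \<comment> \<open>The reflection \<open>y \<mapsto> t - y\<close> preserves Lebesgue measure, so
    the kernel keeps its mass \<open>K\<close>.\<close>
  then have k: "has_bochner_integral lborel (\<lambda>y. frac_kernel (b - a) \<beta> (t - y) * M) (K * M)"
    using lborel_has_bochner_integral_real_affine_iff[of "-1" "frac_kernel (b - a) \<beta>" K t]
    by (intro has_bochner_integral_mult_left) simp
  have "norm (RL_integral a \<beta> f t) \<le> (LINT y|lborel. frac_kernel (b - a) \<beta> (t - y) * M) / Gamma \<beta>"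
    using assms f \<open>0 \<le> M\<close> has_bochner_integral_integrable[OF integrable.intros[OF k]]
    by (intro norm_RL_integral_le) (auto simp: has_bochner_integral_iff)
  then show ?thesis using has_bochner_integral_integral_eq[OF k] by (simp add: K_def)
qed

text \<open>A form of Young's convolution inequality: the pointwise bound by \<open>h\<close> replaces the
  \<open>L\<^sup>p\<close> norm estimate.\<close>

lemma RL_integral_powr_bound:
  fixes f :: "real \<Rightarrow> 'a::euclidean_space"
  assumes "a < b" "0 < \<beta>" "1 < p"
    and f: "set_integrable lborel {a..b} (\<lambda>t. norm (f t) powr p)"
  defines "K \<equiv> (b - a) powr \<beta> / \<beta>"
  obtains h where "\<And>t. 0 \<le> h t"
    and "has_bochner_integral lborel h (K * (LINT t:{a..b}|lborel. norm (f t) powr p))"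
    and "AE t in lborel. t \<in> {a..b} \<longrightarrow>
      norm (RL_integral a \<beta> f t) powr p \<le> ((K + 1) / Gamma \<beta>) powr p * (1 + h t)"
proof -
  define k where "k = frac_kernel (b - a) \<beta>"
  define g where "g = (\<lambda>t. indicator {a..b} t * norm (f t) powr p)"
  define h where "h = (\<lambda>t. LINT y|lborel. k (t - y) * g y)"
  have k: "has_bochner_integral lborel k K"
    using has_bochner_integral_frac_kernel[of "b - a" \<beta>] assms by (simp add: K_def k_def)
  have g: "has_bochner_integral lborel g (LINT t:{a..b}|lborel. norm (f t) powr p)"
    using f by (simp add: has_bochner_integral_iff g_def set_integrable_def set_lebesgue_integral_def)
  have nn: "0 \<le> k x" "0 \<le> g x" for x by (auto simp: k_def g_def)
  note conv = convolution_integrable[OF k g nn]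
  have h: "0 \<le> h t" for t using nn by (auto simp: h_def)
  have "0 \<le> K" using assms by (simp add: K_def)
  have "norm (RL_integral a \<beta> f t) powr p \<le> ((K + 1) / Gamma \<beta>) powr p * (1 + h t)"
    if t: "t \<in> {a..b}" and int: "integrable lborel (\<lambda>y. k (t - y) * g y)" for t
  proof -
    \<comment> \<open>The parameter depends on \<open>t\<close> through the convolution
      \<open>h t\<close>. Thus \<open>l powr p = 1 + h t\<close>, and the final bound is affine in
      \<open>h\<close>.\<close>
    define l where "l = (1 + h t) powr (1/p)"
    have "0 < l" using h[of t] by (simp add: l_def)
    have kl: "has_bochner_integral lborel (\<lambda>y. k (t - y) * l) (K * l)"
      using lborel_has_bochner_integral_real_affine_iff[of "-1" k K t] k
      by (intro has_bochner_integral_mult_left) simp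
    have "has_bochner_integral lborel (\<lambda>y. k (t - y) * l + l powr (1 - p) * (k (t - y) * g y))
        (K * l + l powr (1 - p) * h t)"
      using int by (intro has_bochner_integral_add kl has_bochner_integral_mult_right) (simp add: has_bochner_integral_iff h_def)
    then have I: "has_bochner_integral lborel (\<lambda>y. k (t - y) * (l + l powr (1 - p) * g y)) (K * l + l powr (1 - p) * h t)"
      by (simp add: algebra_simps)
    have "norm (RL_integral a \<beta> f t) \<le> (LINT y|lborel. k (t - y) * (l + l powr (1 - p) * g y)) / Gamma \<beta>"
      unfolding k_def
    proof (rule norm_RL_integral_le)
      fix y assume "y \<in> {a..t}"
      then show "norm (f y) \<le> l + l powr (1 - p) * g y"
        using norm_le_scaled_powr[of "norm (f y)" l p] \<open>0 < l\<close> assms t by (simp add: g_def)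
    next
      show "0 \<le> l + l powr (1 - p) * g y" for y using \<open>0 < l\<close> nn(2)[of y] by simp
    qed (use assms t I in \<open>auto simp: has_bochner_integral_iff k_def\<close>)
    also have "\<dots> = (K * l + l powr (1 - p) * h t) / Gamma \<beta>"
      using has_bochner_integral_integral_eq[OF I] by simp
    also have "\<dots> \<le> ((K + 1) * l) / Gamma \<beta>"
      using scaled_powr_le[OF h[of t] \<open>1 < p\<close>, of K] Gamma_real_pos[OF \<open>0 < \<beta>\<close>]
      by (intro divide_right_mono) (auto simp: l_def)
    finally have "norm (RL_integral a \<beta> f t) \<le> (K + 1) / Gamma \<beta> * l" by simp
    then have "norm (RL_integral a \<beta> f t) powr p \<le> ((K + 1) / Gamma \<beta> * l) powr p"
      using \<open>1 < p\<close> by (intro powr_mono2) auto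
    also have "\<dots> = ((K + 1) / Gamma \<beta>) powr p * l powr p" by (rule powr_mult)
    also have "l powr p = 1 + h t" using h[of t] \<open>1 < p\<close> by (simp add: l_def powr_powr)
    finally show ?thesis .
  qed
  \<comment> \<open>The pointwise bound needs an integrable convolution integrand, which Fubini's
    theorem supplies only for almost every \<open>t\<close>.\<close>
  then have "AE t in lborel. t \<in> {a..b} \<longrightarrow>
      norm (RL_integral a \<beta> f t) powr p \<le> ((K + 1) / Gamma \<beta>) powr p * (1 + h t)"
    using conv(1) by (auto elim: eventually_mono)
  with that[of h] h conv(2) show thesis by (simp add: h_def)
qed

section \<open>The integrated lower bound and coercivity\<close>

text \<open>An almost everywhere comparison is the right form here, as the Caputo derivative is
  controlled only almost everywhere.\<close>

lemma set_integral_lower_boundI: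
  fixes F G :: "real \<Rightarrow> real"
  assumes "set_integrable lborel {a..b} F" "has_bochner_integral lborel (\<lambda>t. indicator {a..b} t * G t) I"
    and "AE t in lborel. t \<in> {a..b} \<longrightarrow> G t \<le> F t"
  shows "I \<le> (LINT t:{a..b}|lborel. F t)"
proof -
  have "(LINT t|lborel. indicator {a..b} t * G t) \<le> (LINT t|lborel. indicator {a..b} t *\<^sub>R F t)"
    using assms by (intro integral_mono_AE) 
      (auto simp: has_bochner_integral_iff set_integrable_def elim!: eventually_mono split: split_indicator)
  then show ?thesis
    using has_bochner_integral_integral_eq[OF assms(2)] by (simp add: set_lebesgue_integral_def)
qed

theorem proposition3p7:
  fixes a b p \<alpha> c0 :: real
    and u0 :: "real ^ 'd"
    and L :: "(real ^ 'd) \<times> (real ^ 'd) \<times> (real ^ 'd) \<times> (real ^ 'd) \<times> real \<Rightarrow> real"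
    and N :: nat
    and c d1 d2 d3 d4 :: "nat \<Rightarrow> real"
  assumes "a < b" and "1 < p" and "0 < \<alpha>" and "\<alpha> < 1"
    and "C1_on (UNIV \<times> UNIV \<times> UNIV \<times> UNIV \<times> {a..b}) L"
    and "\<forall>u \<in> W1p_init a b p u0. set_integrable lborel {a..b} (lagrangian_at L a b \<alpha> u)"
    and "c0 > 0" and "N \<ge> 1"
    and "\<forall>k\<in>{1..N}. d1 k \<ge> 0 \<and> d2 k \<ge> 0 \<and> d3 k \<ge> 0 \<and> d4 k \<ge> 0"
    and "\<forall>k\<in>{1..N}. 0 \<le> d1 k + d2 k + d3 k + d4 k \<and> d1 k + d2 k + d3 k + d4 k < p"
    and "\<forall>x1 x2 x3 x4. \<forall>t\<in>{a..b}.
           L (x1, x2, x3, x4, t) \<ge>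
             c0 * norm x3 powr p +
             (\<Sum>k=1..N. c k * rpow (norm x1) (d1 k) * rpow (norm x2) (d2 k)
                           * rpow (norm x3) (d3 k) * rpow (norm x4) (d4 k))"
  shows "coercive_on a b p (W1p_init a b p u0) (frac_functional L a b \<alpha>)"
proof -
  \<comment> \<open>\<open>C1\<close>, \<open>C2\<close> and \<open>C4\<close> are the factors in
    the bounds for the \<open>p\<close>-th powers of the first, second and fourth arguments of
    \<open>L\<close>; the third contributes \<open>A\<close> itself. \<open>D\<close> is the
    resulting coefficient of \<open>A\<close> after integration, and \<open>e\<close> is chosen so
    that \<open>e * D = c0 / 2\<close>.\<close>
  define T where "T = b - a"
  define B where "B = norm u0 + (T + 1)"
  define K where "K = T powr (1 - \<alpha>) / (1 - \<alpha>)"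
  define C1 where "C1 = B powr p"
  define C2 where "C2 = (T powr \<alpha> / \<alpha> / Gamma \<alpha> * B) powr p"
  define C4 where "C4 = ((K + 1) / Gamma (1 - \<alpha>)) powr p"
  define D where "D = T * (C1 + C2) + 1 + C4 * K"
  define e where "e = c0 / (2 * D)"
  have T: "0 < T" using \<open>a < b\<close> by (simp add: T_def)
  have C: "0 \<le> C1" "0 \<le> C2" "0 \<le> C4" "0 \<le> K" "0 < B"
    using \<open>\<alpha> < 1\<close> T by (auto simp: C1_def C2_def C4_def K_def B_def add_nonneg_pos)
  then have D: "0 < D" using T by (auto simp: D_def add_nonneg_pos add_pos_nonneg)
  then have e: "0 < e" "e * D = c0 / 2" using \<open>0 < c0\<close> by (auto simp: e_def)
  obtain E where "0 \<le> E" and E: "\<And>n1 n2 n3 n4. 0 \<le> n1 \<Longrightarrow> 0 \<le> n2 \<Longrightarrow> 0 \<le> n3 \<Longrightarrow> 0 \<le> n4 \<Longrightarrow>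
    (\<Sum>k=1..N. c k * rpow n1 (d1 k) * rpow n2 (d2 k) * rpow n3 (d3 k) * rpow n4 (d4 k))
      \<ge> - e * (n1 powr p + n2 powr p + n3 powr p + n4 powr p) - E"
    using mixed_power_sum_lower_bound[of N d1 d2 d3 d4 p e c] assms(9,10) \<open>1 < p\<close> \<open>0 < e\<close> by auto
  \<comment> \<open>The part of the integrated error that does not depend on
    \<open>A\<close>.\<close>
  define Q where "Q = e * (T * (C1 + C2) + C4 * T) + E * T"
  show ?thesis
  proof (rule coercive_onI)
    fix u assume u: "u \<in> W1p_init a b p u0"
    define v where "v = weak_deriv a b u"
    define A where "A = (LINT t:{a..b}|lborel. norm (v t) powr p)"
    define l where "l = (1 + A) powr (1/p)"
    have uW: "u \<in> W1p a b p" "u a = u0" using u by (auto simp: W1p_init_def)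
    note W = W1pD[OF uW(1), folded v_def]
    have A: "0 \<le> A" by (simp add: A_def set_lebesgue_integral_def)
    have l: "0 < l" "l powr p = 1 + A" using A \<open>1 < p\<close> by (auto simp: l_def powr_powr)
    have u_le: "norm (u t) \<le> B * l" if "t \<in> {a..b}" for t
      using W1p_sup_bound[OF \<open>a < b\<close> \<open>1 < p\<close> uW(1) that] uW(2)
      by (simp add: B_def T_def l_def A_def v_def)
    have up: "norm (u t) powr p \<le> C1 * (1 + A)" if "t \<in> {a..b}" for t
    proof -
      have "norm (u t) powr p \<le> (B * l) powr p" using u_le[OF that] \<open>1 < p\<close> by (intro powr_mono2) auto
      also have "\<dots> = C1 * (1 + A)" using l C by (simp add: powr_mult C1_def)
      finally show ?thesis .
    qed
    have Ip: "norm (RL_integral a \<alpha> u t) powr p \<le> C2 * (1 + A)" if "t \<in> {a..b}" for t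
    proof -
      have "norm (RL_integral a \<alpha> u t) \<le> T powr \<alpha> / \<alpha> / Gamma \<alpha> * (B * l)"
        using RL_integral_bounded[OF \<open>a < b\<close> \<open>0 < \<alpha>\<close> that u_le] by (simp add: T_def)
      then have "norm (RL_integral a \<alpha> u t) powr p \<le> (T powr \<alpha> / \<alpha> / Gamma \<alpha> * B * l) powr p"
        using \<open>1 < p\<close> by (intro powr_mono2) (auto simp: mult.assoc)
      also have "\<dots> = C2 * (1 + A)"
        unfolding C2_def l(2)[symmetric] by (rule powr_mult)
      finally show ?thesis .
    qed
    have "0 < 1 - \<alpha>" using \<open>\<alpha> < 1\<close> by simp
    obtain h where h0: "\<And>t. 0 \<le> h t" and h: "has_bochner_integral lborel h (K * A)"
      and hp: "AE t in lborel. t \<in> {a..b} \<longrightarrow> norm (caputo_deriv a b \<alpha> u t) powr p \<le> C4 * (1 + h t)"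
    proof (rule RL_integral_powr_bound[OF \<open>a < b\<close> \<open>0 < 1 - \<alpha>\<close> \<open>1 < p\<close> W(4)], goal_cases)
      case (1 h)
      then show ?thesis
        by (intro that[of h]) (simp_all add: caputo_deriv_def K_def C4_def T_def A_def v_def)
    qed
    \<comment> \<open>A minorant of the integrand along \<open>u\<close>: the first, second and
      fourth arguments are replaced by their bounds, so only \<open>norm (v t) powr p\<close>,
      \<open>h\<close> and constants have to be integrated.\<close>
    define G where "G = (\<lambda>t. (c0 - e) * norm (v t) powr p - e * C4 * h t
        - (e * (C1 * (1 + A) + C2 * (1 + A) + C4) + E))"
    have hI: "integrable lborel (\<lambda>t. indicator {a..b} t * h t)"
      using h integrable_mult_indicator[of "{a..b}" lborel h] by (simp add: has_bochner_integral_iff)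
    \<comment> \<open>The known mass \<open>K * A\<close> of \<open>h\<close> is over the whole
      line; nonnegativity allows restriction to [a, b].\<close>
    have "(LINT t|lborel. indicator {a..b} t * h t) \<le> (LINT t|lborel. h t)"
      using h h0 by (intro integral_mono') (auto simp: has_bochner_integral_iff split: split_indicator)
    then have hle: "(LINT t|lborel. indicator {a..b} t * h t) \<le> K * A"
      using has_bochner_integral_integral_eq[OF h] by simp
    have GI: "has_bochner_integral lborel (\<lambda>t. indicator {a..b} t * G t)
       ((c0 - e) * A - e * C4 * (LINT t|lborel. indicator {a..b} t * h t)
         - T * (e * (C1 * (1 + A) + C2 * (1 + A) + C4) + E))"
    proof -
      have "has_bochner_integral lborel (\<lambda>t. (c0 - e) * (indicator {a..b} t * norm (v t) powr p)
          - e * C4 * (indicator {a..b} t * h t)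
          - indicator {a..b} t * (e * (C1 * (1 + A) + C2 * (1 + A) + C4) + E))
         ((c0 - e) * A - e * C4 * (LINT t|lborel. indicator {a..b} t * h t)
         - T * (e * (C1 * (1 + A) + C2 * (1 + A) + C4) + E))"
      proof (intro has_bochner_integral_diff has_bochner_integral_mult_right has_bochner_integral_mult_left)
        show "has_bochner_integral lborel (\<lambda>t. indicator {a..b} t * norm (v t) powr p) A"
          using W(4) by (simp add: has_bochner_integral_iff set_integrable_def A_def set_lebesgue_integral_def)
        show "has_bochner_integral lborel (indicator {a..b}) T"
          using has_bochner_integral_real_indicator[of "{a..b}" lborel] \<open>a < b\<close> by (simp add: T_def)
      qed (use hI in \<open>simp add: has_bochner_integral_iff\<close>)
      then show ?thesis by (simp add: G_def algebra_simps)
    qed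
    have "(c0 - e) * A - e * C4 * (LINT t|lborel. indicator {a..b} t * h t)
         - T * (e * (C1 * (1 + A) + C2 * (1 + A) + C4) + E) \<le> frac_functional L a b \<alpha> u"
      unfolding frac_functional_def
    proof (rule set_integral_lower_boundI[OF _ GI])
      show "AE t in lborel. t \<in> {a..b} \<longrightarrow> G t \<le> lagrangian_at L a b \<alpha> u t"
        using hp
      proof eventually_elim
        case (elim t)
        show ?case
        proof
          assume t: "t \<in> {a..b}"
          let ?n1 = "norm (u t)" and ?n2 = "norm (RL_integral a \<alpha> u t)" and ?n3 = "norm (v t)"
            and ?n4 = "norm (caputo_deriv a b \<alpha> u t)"
          have "e * (?n1 powr p + ?n2 powr p + ?n3 powr p + ?n4 powr p)
              \<le> e * (C1 * (1 + A) + C2 * (1 + A) + ?n3 powr p + C4 * (1 + h t))"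
            using up[OF t] Ip[OF t] elim t e by (intro mult_left_mono add_mono) auto
          then have "G t \<le> c0 * ?n3 powr p + (- e * (?n1 powr p + ?n2 powr p + ?n3 powr p + ?n4 powr p) - E)"
            by (simp add: G_def algebra_simps)
          also have "\<dots> \<le> c0 * ?n3 powr p + (\<Sum>k=1..N. c k * rpow ?n1 (d1 k) * rpow ?n2 (d2 k)
                           * rpow ?n3 (d3 k) * rpow ?n4 (d4 k))"
            by (intro add_left_mono E) auto
          also have "\<dots> \<le> lagrangian_at L a b \<alpha> u t"
            using assms(11) t by (simp add: lagrangian_at_def v_def)
          finally show "G t \<le> lagrangian_at L a b \<alpha> u t" .
        qed
      qed
    qed (use assms(6) u in auto)
    moreover have "e * C4 * (LINT t|lborel. indicator {a..b} t * h t) \<le> e * C4 * (K * A)"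
      using hle e C by (intro mult_left_mono) auto
    moreover have "(c0 - e) * A - e * C4 * (K * A) - T * (e * (C1 * (1 + A) + C2 * (1 + A) + C4) + E)
        = c0 * A - e * D * A - Q"
      by (simp add: D_def Q_def algebra_simps)
    ultimately have F: "c0 / 2 * A - Q \<le> frac_functional L a b \<alpha> u"
      unfolding e(2) by (simp add: algebra_simps)
    \<comment> \<open>The uniform bound on \<open>u\<close> makes the \<open>p\<close>-th power of
      the Sobolev norm at most affine in \<open>A\<close>, with slope \<open>T * C1 + 1\<close>.
      Dividing \<open>c0 / 2\<close> by this slope gives the factor required by
      \<open>coercive_onI\<close>.\<close>
    have "(LINT t:{a..b}|lborel. norm (u t) powr p) \<le> (LINT t:{a..b}|lborel. C1 * (1 + A))"
      by (intro set_integral_mono W(3) borel_integrable_atLeastAtMost' continuous_on_const up)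
    also have "\<dots> = T * (C1 * (1 + A))"
      using \<open>a < b\<close> by (simp add: set_lebesgue_integral_def T_def)
    finally have W_le: "W1p_norm a b p u powr p \<le> (T * C1 + 1) * A + T * C1"
      unfolding W1p_norm_powr[OF \<open>1 < p\<close>] v_def[symmetric] A_def[symmetric] by (simp add: algebra_simps)
    have pos: "0 < T * C1 + 1" using T C by (simp add: add_nonneg_pos)
    have "c0 / 2 / (T * C1 + 1) * W1p_norm a b p u powr p \<le> c0 / 2 / (T * C1 + 1) * ((T * C1 + 1) * A + T * C1)"
      using W_le pos \<open>0 < c0\<close> by (intro mult_left_mono) auto
    also have "\<dots> = c0 / 2 * A + c0 / 2 / (T * C1 + 1) * (T * C1)"
      using pos by (simp add: field_simps)
    finally show "c0 / 2 / (T * C1 + 1) * W1p_norm a b p u powr p - (c0 / 2 / (T * C1 + 1) * (T * C1) + Q)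
        \<le> frac_functional L a b \<alpha> u"
      using F by linarith
  next
    show "0 < c0 / 2 / (T * C1 + 1)" using T C \<open>0 < c0\<close> by (simp add: add_nonneg_pos)
  qed (use \<open>1 < p\<close> in auto)
qed

end
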